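(* Let $p,q$ be primes with $p\equiv q\equiv 1\pmod 4$, and assume that $p$ is a quadratic nonresidue of $q$. Then there are no positive integers $x,y,z$ with $\gcd(px,qy)=1$ and $$(px^2)^2+(qy^2)^2=z^2.$$
   Context: "$p$ is a quadratic nonresidue of $q$" means that $q\nmid p$ and the congruence $t^2\equiv p\pmod q$ has no integer solution $t$. *)

theory Defs
  imports "HOL-Number_Theory.Number_Theory"
begin

(* QuadRes m a takes the modulus first and also holds when m dvd a. *)
definition quadratic_nonresidue :: "int \<Rightarrow> int \<Rightarrow> bool" where
  "quadratic_nonresidue a m \<longleftrightarrow> \<not> m dvd a \<and> \<not> QuadRes m a"

end

(*
  Write m^2 - n^2 and 2mn for the odd and the even leg of the primitive triple.
  By quadratic reciprocity the roles of p and q can be exchanged, so let p x^2 = m^2 - n^2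
  be odd and q y^2 = 2mn.  If q divides m, then p x^2 = -n^2 modulo q, and -1 is a square
  modulo q.  If q divides n, then m is a square because m (n/2) = q (y/2)^2 with coprime m and n/2;
  moreover (m - n)(m + n) = p x^2 forces one of m - n, m + n to be p s^2, and
  modulo q this reads p s^2 = m.  In both cases p would be a square modulo q.
*)
theory Submission
  imports Defs "HOL-Computational_Algebra.Nth_Powers"
begin

section \<open>Coprime factors of a square or of a prime times a square\<close>

lemma coprime_mult_eq_square_int:
  fixes a b c :: int
  assumes "coprime a b" "a * b = c\<^sup>2" "a > 0" "b > 0"
  obtains d where "a = d\<^sup>2" "d > 0"
proof -
  \<comment> \<open>The passage to \<open>nat\<close>, harmless for positive factors, gives access
    to the result on coprime factors of perfect powers.\<close>
  have "nat a * nat b = (nat \<bar>c\<bar>)\<^sup>2"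
    by (metis abs_ge_zero assms(2,3) nat_mult_distrib nat_power_eq order_less_imp_le power2_abs)
  moreover have "coprime (nat a) (nat b)"
    using assms coprime_int_iff[of "nat a" "nat b"] by simp
  ultimately have "is_nth_power 2 (nat a)"
    using is_nth_power_mult_coprime_natD(1)[of "nat a" "nat b" 2] assms(3,4)
    by (simp add: is_nth_powerI)
  then obtain k where k: "nat a = k\<^sup>2"
    by (auto elim: is_nth_powerE)
  have "a = (int k)\<^sup>2"
    using k assms(3) by (metis int_nat_eq of_nat_power order_less_imp_le)
  moreover from this have "int k > 0"
    using assms(3) by (cases "k = 0") auto
  ultimately show thesis
    using that by blast
qed

text \<open>Cancelling \<open>p\<close> from the factor that it divides leaves two coprime positive
  factors of a square, so both are squares.\<close>

lemma coprime_mult_eq_prime_square_int: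
  fixes a b c p :: int
  assumes "prime p" "coprime a b" "a * b = p * c\<^sup>2" "a > 0" "b > 0" "p dvd a"
  obtains s t where "a = p * s\<^sup>2" "b = t\<^sup>2"
proof -
  have p: "p > 0"
    using assms(1) by (simp add: prime_gt_0_int)
  obtain a' where a': "a = p * a'"
    using assms(6) by blast
  have pos: "a' > 0"
    using a' p assms(4) by (simp add: zero_less_mult_iff)
  have cop: "coprime a' b"
    using a' assms(2) by simp
  have eq: "a' * b = c\<^sup>2"
    using assms(3) a' p by simp
  obtain s where "a' = s\<^sup>2"
    using coprime_mult_eq_square_int[OF cop eq pos assms(5)] by blast
  moreover obtain t where "b = t\<^sup>2"
    using coprime_mult_eq_square_int[of b a' c] cop eq pos assms(5)
    by (metis coprime_commute mult.commute)
  ultimately show thesis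
    using that a' by blast
qed

section \<open>Quadratic residues modulo primes\<close>

lemma QuadRes_mult_square_cancel:
  fixes a s t q :: int
  assumes "prime q" "\<not> q dvd s" "[a * s\<^sup>2 = t\<^sup>2] (mod q)"
  shows "QuadRes q a"
proof -
  have "coprime s q"
    using assms(1,2) prime_imp_coprime coprime_commute by blast
  then obtain r where r: "[s * r = 1] (mod q)"
    using cong_solve_coprime_int by blast
  \<comment> \<open>Since \<open>r\<close> inverts \<open>s\<close> modulo \<open>q\<close>, the
    residue \<open>t * r\<close> is a square root of \<open>a\<close>.\<close>
  have "[(t * r)\<^sup>2 = a * (s * r)\<^sup>2] (mod q)"
    using cong_mult[OF cong_sym[OF assms(3)] cong_refl[of "r\<^sup>2" q]]
    by (simp add: power_mult_distrib mult_ac)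
  also have "[a * (s * r)\<^sup>2 = a * 1\<^sup>2] (mod q)"
    using r by (intro cong_mult cong_pow cong_refl)
  finally show ?thesis
    unfolding QuadRes_def by auto
qed

lemma prime_1_mod_4_gt_2:
  fixes q :: int
  assumes "prime q" "[q = 1] (mod 4)"
  shows "q > 2"
proof -
  have "q \<noteq> 2"
    using assms(2) by (auto simp: cong_def)
  then show ?thesis
    using prime_ge_2_int[OF assms(1)] by simp
qed

text \<open>Euler's criterion with the even exponent (q - 1) / 2 makes the Legendre symbol of -1
  congruent to 1; were it -1, \<open>q\<close> would divide 2.\<close>

lemma QuadRes_minus_one:
  fixes q :: int
  assumes "prime q" "[q = 1] (mod 4)"
  shows "QuadRes q (-1)"
proof (rule ccontr)
  assume nq: "\<not> QuadRes q (-1)"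
  have q2: "q > 2"
    using prime_1_mod_4_gt_2[OF assms] .
  have ev: "even ((nat q - 1) div 2)"
  proof -
    obtain k where k: "q = 1 + 4 * k"
      by (metis assms(2) cong_iff_lin cong_sym)
    then have "nat q - 1 = 2 * (2 * nat k)"
      using q2 by linarith
    then show ?thesis
      by simp
  qed
  have "[Legendre (-1) (int (nat q)) = (-1) ^ ((nat q - 1) div 2)] (mod int (nat q))"
    using assms(1) q2 by (intro euler_criterion) auto
  then have "[Legendre (-1) q = 1] (mod q)"
    using ev q2 by simp
  moreover have "\<not> [-1 = 0] (mod q)"
    using q2 by (auto simp: cong_iff_dvd_diff zdvd_not_zless)
  ultimately have "[-1 = 1] (mod q)"
    using nq by (simp add: Legendre_def)
  then have "q dvd 2"
    by (simp add: cong_iff_dvd_diff)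
  then show False
    using q2 by (simp add: zdvd_not_zless)
qed

text \<open>The exponent in quadratic reciprocity is even, so the two Legendre symbols have product
  1 and are both -1. This lets the two legs be exchanged.\<close>

lemma quadratic_nonresidue_commute:
  fixes p q :: int
  assumes "prime p" "prime q" "[p = 1] (mod 4)" "[q = 1] (mod 4)"
    and "quadratic_nonresidue p q"
  shows "quadratic_nonresidue q p"
proof -
  have gt: "p > 2" "q > 2"
    using prime_1_mod_4_gt_2 assms by blast+
  have ne: "p \<noteq> q"
    using assms(5) by (auto simp: quadratic_nonresidue_def)
  then have nd: "\<not> p dvd q"
    using assms(1,2) primes_dvd_imp_eq by blast
  have "even ((p - 1) div 2)"
  proof -
    obtain k where "p = 1 + 4 * k"
      by (metis assms(3) cong_iff_lin cong_sym)
    then show ?thesis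
      by simp
  qed
  then have "even (nat ((p - 1) div 2 * ((q - 1) div 2)))"
    using gt by (simp add: even_nat_iff)
  then have "Legendre p q * Legendre q p = 1"
    using Quadratic_Reciprocity_int[of p q] assms(1,2) gt ne by simp
  moreover have "Legendre p q = -1"
    using assms(5) by (simp add: Legendre_def quadratic_nonresidue_def cong_0_iff)
  ultimately have "Legendre q p = -1"
    by simp
  then show ?thesis
    using nd by (auto simp: Legendre_def quadratic_nonresidue_def split: if_splits)
qed

section \<open>Impossibility when the leg \<open>q * y\<^sup>2\<close> is even\<close>

lemma no_solution_even_leg:
  fixes p q x y z :: int
  assumes p: "prime p" and q: "prime q"
    and p4: "[p = 1] (mod 4)" and q4: "[q = 1] (mod 4)"
    and nr: "\<not> QuadRes q p"
    and pos: "x > 0" "y > 0" "z > 0"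
    and cop: "coprime (p * x) (q * y)"
    and eq: "(p * x\<^sup>2)\<^sup>2 + (q * y\<^sup>2)\<^sup>2 = z\<^sup>2"
    and ev: "even y"
  shows False
proof -
  have p0: "p > 0" and q0: "q > 0"
    using p q by (simp_all add: prime_gt_0_int)
  obtain w where w: "y = 2 * w"
    using ev by blast
  have odd_px: "odd p" "odd x"
    using cop ev by (auto simp: coprime_common_divisor_int dest: coprime_common_divisor[of _ _ 2])
  have odd_z: "odd z"
  proof -
    have "odd (z\<^sup>2)"
      unfolding eq[symmetric] using odd_px ev by simp
    then show ?thesis
      by simp
  qed
  have qx: "\<not> q dvd x"
    using cop q by (metis coprime_common_divisor dvd_mult dvd_triv_left not_prime_unit)
  have cop2: "coprime (p * x\<^sup>2) (q * y\<^sup>2)"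
    using cop by simp
  have copz: "coprime (p * x\<^sup>2) z"
  proof -
    have "coprime (p * x\<^sup>2) (p * x\<^sup>2 * (p * x\<^sup>2) + (q * y\<^sup>2)\<^sup>2)"
      unfolding coprime_iff_gcd_eq_1 gcd_add_mult
      using cop2 by (simp flip: coprime_iff_gcd_eq_1)
    also have "p * x\<^sup>2 * (p * x\<^sup>2) + (q * y\<^sup>2)\<^sup>2 = z\<^sup>2"
      using eq by (simp add: power2_eq_square)
    finally show ?thesis
      by simp
  qed
  have "even (z - p * x\<^sup>2)"
    using odd_px odd_z by simp
  \<comment> \<open>Here \<open>u\<close> and \<open>v\<close> are half the difference and half the
    sum of \<open>z\<close> and the odd leg; their product is the square of half the even
    leg.\<close>
  then obtain u where u: "z - p * x\<^sup>2 = 2 * u"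
    by blast
  define v where "v = u + p * x\<^sup>2"
  have zuv: "z = u + v" and pv: "p * x\<^sup>2 = v - u"
    using u by (simp_all add: v_def)
  have uv: "u * v = (2 * q * w\<^sup>2)\<^sup>2"
    using eq unfolding zuv pv w by (simp add: power2_eq_square algebra_simps)
  have "p * x\<^sup>2 > 0"
    using p0 pos by simp
  then have "v > u"
    using pv by linarith
  moreover have "u * v > 0"
    unfolding uv using q0 pos w by simp
  moreover have "u + v > 0"
    using pos zuv by simp
  ultimately have upos: "u > 0" "v > 0"
    by (smt (verit) zero_less_mult_iff)+
  have copuv: "coprime u v"
  proof (rule coprimeI)
    fix d assume "d dvd u" "d dvd v"
    then have "d dvd p * x\<^sup>2" "d dvd z"
      by (simp_all add: zuv pv)
    then show "is_unit d"
      using copz coprime_common_divisor by blast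
  qed
  \<comment> \<open>Coprime positive factors of a square are squares, which yields Euclid's
    parameters \<open>m\<close> and \<open>n\<close> of the triple.\<close>
  obtain n where n: "u = n\<^sup>2" "n > 0"
    using coprime_mult_eq_square_int[OF copuv uv upos] .
  obtain m where m: "v = m\<^sup>2" "m > 0"
    using coprime_mult_eq_square_int[of v u "2 * q * w\<^sup>2"] copuv uv upos
    by (metis coprime_commute mult.commute)
  have "(m * n)\<^sup>2 = (2 * q * w\<^sup>2)\<^sup>2"
    using uv n m by (simp add: power_mult_distrib mult.commute)
  then have mn: "m * n = 2 * q * w\<^sup>2"
    using n(2) m(2) q0 by (simp add: power2_eq_iff_nonneg)
  have px: "p * x\<^sup>2 = m\<^sup>2 - n\<^sup>2"
    using pv n m by simp
  have copmn: "coprime m n"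
    using copuv n m by (simp add: coprime_commute)
  have px4: "(p * x\<^sup>2) mod 4 = 1"
  proof -
    obtain j where "x = 2 * j + 1"
      using odd_px(2) oddE by blast
    then have "x\<^sup>2 - 1 = 4 * (j\<^sup>2 + j)"
      by (simp add: power2_eq_square algebra_simps)
    then have "[x\<^sup>2 = 1] (mod 4)"
      by (simp add: cong_iff_dvd_diff)
    from cong_mult[OF p4 this] show ?thesis
      by (simp add: cong_def)
  qed
  \<comment> \<open>One of \<open>m\<close>, \<open>n\<close> is even. If it were \<open>m\<close>,
    the odd leg would be 3 modulo 4, against \<open>px4\<close>.\<close>
  have "even n"
  proof (rule ccontr)
    assume "odd n"
    moreover have "even (m * n)"
      using mn by simp
    ultimately obtain i j where "m = 2 * i" "n = 2 * j + 1"
      by (auto elim!: evenE oddE)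
    then have "p * x\<^sup>2 = 3 + 4 * (i\<^sup>2 - j\<^sup>2 - j - 1)"
      using px by (simp add: power2_eq_square algebra_simps)
    then show False
      using px4 by presburger
  qed
  then obtain k where k: "n = 2 * k"
    by blast
  \<comment> \<open>Halving \<open>mn\<close> leaves \<open>q\<close> times a square, so the prime
    \<open>q\<close> divides \<open>m\<close> or \<open>k\<close>.\<close>
  have mk: "m * k = q * w\<^sup>2" "k > 0"
    using mn k n(2) by simp_all
  then have "q dvd m \<or> q dvd k"
    using q by (metis dvd_triv_left prime_dvd_mult_iff)
  then show False
  proof
    assume "q dvd m"
    obtain i where i: "[i\<^sup>2 = -1] (mod q)"
      using QuadRes_minus_one[OF q q4] by (auto simp: QuadRes_def)
    have "[p * x\<^sup>2 = (-1) * n\<^sup>2] (mod q)"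
      unfolding px using \<open>q dvd m\<close> by (simp add: cong_iff_dvd_diff power2_eq_square)
    also have "[(-1) * n\<^sup>2 = i\<^sup>2 * n\<^sup>2] (mod q)"
      using i by (intro cong_mult cong_refl) (rule cong_sym)
    finally have "[p * x\<^sup>2 = (i * n)\<^sup>2] (mod q)"
      by (simp add: power_mult_distrib)
    then show False
      using QuadRes_mult_square_cancel[OF q qx] nr by blast
  next
    assume "q dvd k"
    have copkm: "coprime k m"
      using copmn k by (simp add: coprime_commute)
    \<comment> \<open>The prime \<open>q\<close> sits in \<open>k\<close>, so the coprime cofactor
      \<open>m\<close> is a square; \<open>a\<close> will be the square root of
      \<open>p * s\<^sup>2\<close> modulo \<open>q\<close>.\<close>
    obtain a where a: "m = a\<^sup>2"
      using coprime_mult_eq_prime_square_int[OF q copkm _ mk(2) m(2) \<open>q dvd k\<close>] mk(1)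
      by (metis mult.commute)
    have prod: "(m - n) * (m + n) = p * x\<^sup>2"
      unfolding px by (simp add: power2_eq_square algebra_simps)
    have "(m - n) * (m + n) > 0"
      unfolding prod using p0 pos by simp
    then have fpos: "m - n > 0" "m + n > 0"
      using m(2) n(2) by (auto simp: zero_less_mult_iff)
    have copf: "coprime (m - n) (m + n)"
    proof (rule coprimeI)
      fix d assume d: "d dvd m - n" "d dvd m + n"
      \<comment> \<open>A common divisor \<open>d\<close> is odd, so it can be cancelled against the
        2 in \<open>2 * m\<close> and \<open>2 * n\<close>.\<close>
      have "odd (m - n)"
        using prod odd_px by (metis even_mult_iff even_power)
      then have "coprime d 2"
        using d(1) by (metis coprime_right_2_iff_odd dvd_trans)
      moreover have "d dvd 2 * m" "d dvd 2 * n"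
        using dvd_add[OF d] dvd_diff[OF d(2,1)] by simp_all
      ultimately have "d dvd m" "d dvd n"
        by (simp_all add: coprime_dvd_mult_right_iff)
      then show "is_unit d"
        using copmn coprime_common_divisor by blast
    qed
    \<comment> \<open>Stated for a general \<open>e\<close> to serve both \<open>m - n\<close> and
      \<open>m + n\<close>. Cancelling \<open>p\<close> shows that \<open>s\<close> divides
      \<open>x\<close>, so \<open>q\<close> does not divide \<open>s\<close> and \<open>s\<close> is
      invertible modulo \<open>q\<close>.\<close>
    have contra: False if "e = p * s\<^sup>2" "e dvd p * x\<^sup>2" "[e = m] (mod q)" for e s
    proof -
      have "s\<^sup>2 dvd x\<^sup>2"
        using that(1,2) p0 by simp
      then have "s dvd x"
        by simp
      then have "\<not> q dvd s"
        using qx dvd_trans by blast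
      moreover have "[p * s\<^sup>2 = a\<^sup>2] (mod q)"
        using that a by simp
      ultimately show False
        using QuadRes_mult_square_cancel[OF q] nr by blast
    qed
    have "q dvd n"
      using \<open>q dvd k\<close> k by simp
    then have cong: "[m - n = m] (mod q)" "[m + n = m] (mod q)"
      by (simp_all add: cong_iff_dvd_diff)
    have dvds: "m - n dvd p * x\<^sup>2" "m + n dvd p * x\<^sup>2"
      unfolding prod[symmetric] by simp_all
    have "p dvd m - n \<or> p dvd m + n"
      using p prod by (metis dvd_triv_left prime_dvd_mult_iff)
    then show False
    proof
      assume "p dvd m - n"
      then obtain s where "m - n = p * s\<^sup>2"
        using coprime_mult_eq_prime_square_int[OF p copf prod fpos] by blast
      then show False
        using contra cong(1) dvds(1) by blast
    next
      assume "p dvd m + n"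
      moreover have "coprime (m + n) (m - n)" "(m + n) * (m - n) = p * x\<^sup>2"
        using copf prod by (simp_all add: coprime_commute mult.commute)
      ultimately obtain s where "m + n = p * s\<^sup>2"
        using coprime_mult_eq_prime_square_int[OF p _ _ fpos(2,1)] by blast
      then show False
        using contra cong(2) dvds(2) by blast
    qed
  qed
qed

section \<open>Parity of the legs and conclusion\<close>

lemma sum_two_squares_imp_even:
  fixes a b c :: int
  assumes "a\<^sup>2 + b\<^sup>2 = c\<^sup>2"
  shows "even a \<or> even b"
proof (rule ccontr)
  assume "\<not> (even a \<or> even b)"
  then obtain i j where ij: "a = 2 * i + 1" "b = 2 * j + 1"
    by (meson oddE)
  \<comment> \<open>Two odd squares add up to 2 modulo 4, whereas an even square is divisible by
    4.\<close>
  have eq: "c\<^sup>2 = 2 + 4 * (i\<^sup>2 + i + j\<^sup>2 + j)"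
    using assms unfolding ij by (simp add: power2_eq_square algebra_simps)
  then have "even (c\<^sup>2)"
    by simp
  then obtain l where "c = 2 * l"
    by (auto elim: evenE)
  then have "c\<^sup>2 = 4 * l\<^sup>2"
    by simp
  with eq show False
    by presburger
qed

theorem theorem3:
  fixes p q :: int
  assumes "prime p" and "prime q"
    and "[p = 1] (mod 4)" and "[q = 1] (mod 4)"
    and "quadratic_nonresidue p q"
  shows "\<not> (\<exists>x y z :: int. x > 0 \<and> y > 0 \<and> z > 0 \<and>
           gcd (p * x) (q * y) = 1 \<and>
           (p * x^2)^2 + (q * y^2)^2 = z^2)"
proof
  assume "\<exists>x y z :: int. x > 0 \<and> y > 0 \<and> z > 0 \<and>
           gcd (p * x) (q * y) = 1 \<and> (p * x^2)^2 + (q * y^2)^2 = z^2"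
  then obtain x y z :: int where pos: "x > 0" "y > 0" "z > 0"
    and cop: "coprime (p * x) (q * y)"
    and eq: "(p * x\<^sup>2)\<^sup>2 + (q * y\<^sup>2)\<^sup>2 = z\<^sup>2"
    by (auto simp: coprime_iff_gcd_eq_1)
  have nr: "\<not> QuadRes q p" "\<not> QuadRes p q"
    using assms(5) quadratic_nonresidue_commute[OF assms]
    by (simp_all add: quadratic_nonresidue_def)
  have "odd p" "odd q"
    using assms(1-4) prime_1_mod_4_gt_2 prime_odd_int by blast+
  then have "even x \<or> even y"
    using sum_two_squares_imp_even[OF eq] by simp
  then show False
  proof
    \<comment> \<open>The even-leg case applies with \<open>p\<close>, \<open>x\<close> and
      \<open>q\<close>, \<open>y\<close> exchanged; reciprocity has supplied the nonresidue
      condition in this direction.\<close>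
    assume "even x"
    moreover have "coprime (q * y) (p * x)" "(q * y\<^sup>2)\<^sup>2 + (p * x\<^sup>2)\<^sup>2 = z\<^sup>2"
      using cop eq by (simp_all add: coprime_commute add.commute)
    ultimately show False
      using no_solution_even_leg[OF assms(2,1,4,3) nr(2) pos(2,1,3)] by blast
  next
    assume "even y"
    then show False
      using no_solution_even_leg[OF assms(1-4) nr(1) pos cop eq] by blast
  qed
qed

end
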